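(* Let $k\in\mathbb{N}$ and let $(X,f_{1,\infty})$ be a commutative and $k$-periodic non-autonomous discrete system such that every $f_i$ is surjective and $X$ is a compact metric space without isolated points. Suppose that $f_{1,\infty}$ is topologically transitive and that there exists a nonrecurrent point $x_1\in X$, i.e. $x_1\notin\overline{\{f_1^i(x_1):i\ge 1\}}$. Then $f_{1,\infty}$ is sensitive.
   Context: $\mathbb{N}=\{1,2,3,\dots\}$. A non-autonomous discrete system (NDS) $(X,f_{1,\infty})$ consists of a metric space $(X,d)$ and a sequence $f_{1,\infty}=(f_n)_{n=1}^\infty$ of continuous maps $f_n:X\to X$. For $i,n\in\mathbb{N}$, $f_i^n:=f_{i+n-1}\circ\cdots\circ f_i$. The NDS is $k$-periodic if $f_{n+k}=f_n$ for all $n\in\mathbb{N}$. Commutative: $f_i\circ f_j=f_j\circ f_i$ for all $i,j\in\mathbb{N}$. Topologically transitive: for any two non-empty open sets $U,V\subseteq X$ there is $n\in\mathbb{N}$ with $f_1^n(U)\cap V\neq\emptyset$. Sensitive: there is $\delta>0$ such that for any non-empty open set $U\subseteq X$ there exist $x,y\in U$ and $n\in\mathbb{N}$ with $d(f_1^n(x),f_1^n(y))>\delta$. *)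

theory Defs
  imports "HOL-Analysis.Analysis"
begin

text \<open>
  The space \<open>X\<close> is a carrier set inside a type of class \<^class>\<open>metric_space\<close>, with the
  metric \<^const>\<open>dist\<close> restricted to \<open>X\<close>; topological notions are relative to
  \<open>top_of_set X\<close>. Sequences are indexed from 1, so \<open>f 0\<close> is never used, and each
  \<open>f n\<close> matters only on \<open>X\<close>.
\<close>

definition nds :: "'a::metric_space set \<Rightarrow> (nat \<Rightarrow> 'a \<Rightarrow> 'a) \<Rightarrow> bool" where
  "nds X f \<longleftrightarrow> (\<forall>n\<ge>1. f n \<in> X \<rightarrow> X \<and> continuous_on X (f n))"

text \<open>
  \<open>nds_iter f i n\<close> is \<open>f (i + n - 1) \<circ> \<dots> \<circ> f i\<close>, with \<open>n\<close> factors;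
  the value at \<open>n = 0\<close> only serves to start the recursion.
\<close>

primrec nds_iter :: "(nat \<Rightarrow> 'a \<Rightarrow> 'a) \<Rightarrow> nat \<Rightarrow> nat \<Rightarrow> 'a \<Rightarrow> 'a" where
  "nds_iter f i 0 = id"
| "nds_iter f i (Suc n) = f (i + n) \<circ> nds_iter f i n"

definition nds_periodic :: "'a set \<Rightarrow> (nat \<Rightarrow> 'a \<Rightarrow> 'a) \<Rightarrow> nat \<Rightarrow> bool" where
  "nds_periodic X f k \<longleftrightarrow> (\<forall>n\<ge>1. \<forall>x\<in>X. f (n + k) x = f n x)"

definition nds_commutative :: "'a set \<Rightarrow> (nat \<Rightarrow> 'a \<Rightarrow> 'a) \<Rightarrow> bool" where
  "nds_commutative X f \<longleftrightarrow> (\<forall>i\<ge>1. \<forall>j\<ge>1. \<forall>x\<in>X. f i (f j x) = f j (f i x))"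

definition nds_transitive :: "'a::metric_space set \<Rightarrow> (nat \<Rightarrow> 'a \<Rightarrow> 'a) \<Rightarrow> bool" where
  "nds_transitive X f \<longleftrightarrow>
    (\<forall>U V. openin (top_of_set X) U \<and> U \<noteq> {} \<and> openin (top_of_set X) V \<and> V \<noteq> {} \<longrightarrow>
      (\<exists>n\<ge>1. nds_iter f 1 n ` U \<inter> V \<noteq> {}))"

definition nds_sensitive :: "'a::metric_space set \<Rightarrow> (nat \<Rightarrow> 'a \<Rightarrow> 'a) \<Rightarrow> bool" where
  "nds_sensitive X f \<longleftrightarrow>
    (\<exists>\<delta>>0. \<forall>U. openin (top_of_set X) U \<and> U \<noteq> {} \<longrightarrow>
      (\<exists>x\<in>U. \<exists>y\<in>U. \<exists>n\<ge>1. dist (nds_iter f 1 n x) (nds_iter f 1 n y) > \<delta>))"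

definition nds_nonrecurrent :: "'a::metric_space set \<Rightarrow> (nat \<Rightarrow> 'a \<Rightarrow> 'a) \<Rightarrow> 'a \<Rightarrow> bool" where
  "nds_nonrecurrent X f x \<longleftrightarrow>
    x \<in> X \<and> x \<notin> top_of_set X closure_of {nds_iter f 1 i x | i. i \<ge> 1}"

end

theory Submission
  imports Defs
begin

text \<open>
  If sensitivity fails for the constant \<open>\<delta>\<close>, some non-empty open \<open>U\<close> has all its iterates of
  diameter at most \<open>\<delta>\<close>. Transitivity gives \<open>n\<close> such that \<open>U' = U \<inter> (f\<^sub>1\<^sup>n)\<inverse>(U)\<close> is non-empty;
  by commutativity \<open>f\<^sub>1\<^sup>n\<close> then moves every point of the forward orbit of \<open>U'\<close> by at most \<open>\<delta>\<close>.
  That orbit is dense, so \<open>f\<^sub>1\<^sup>n\<close> moves every point of \<open>X\<close> by at most \<open>\<delta>\<close>, which is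
  impossible at a nonrecurrent point once \<open>\<delta>\<close> is small.
\<close>

lemma nds_iter_in:
  assumes "nds X f" "i \<ge> 1" "x \<in> X"
  shows "nds_iter f i n x \<in> X"
proof (induction n)
  case (Suc n)
  have "f (i + n) \<in> X \<rightarrow> X"
    using assms(1,2) by (simp add: nds_def)
  with Suc show ?case by auto
qed (simp add: assms)

lemma continuous_on_nds_iter:
  assumes "nds X f" "i \<ge> 1"
  shows "continuous_on X (nds_iter f i n)"
proof (induction n)
  case (Suc n)
  have "continuous_on X (f (i + n))"
    using assms by (simp add: nds_def)
  moreover have "nds_iter f i n ` X \<subseteq> X"
    using nds_iter_in[OF assms] by blast
  ultimately have "continuous_on (nds_iter f i n ` X) (f (i + n))"
    by (rule continuous_on_subset)
  with Suc show ?case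
    by (simp only: nds_iter.simps continuous_on_compose)
qed (simp add: id_def)

text \<open>Moves a single map past the factors of an iterate one at a time; the orbit must stay in
  \<open>X\<close>, since the maps commute only there.\<close>

lemma nds_iter_commute_map:
  assumes "nds X f" "nds_commutative X f" "i \<ge> 1" "j \<ge> 1" "x \<in> X"
  shows "f j (nds_iter f i n x) = nds_iter f i n (f j x)"
proof (induction n)
  case (Suc n)
  have "f j (f (i + n) (nds_iter f i n x)) = f (i + n) (f j (nds_iter f i n x))"
    using assms(2-4) nds_iter_in[OF assms(1,3,5)] unfolding nds_commutative_def
    by (metis trans_le_add1)
  with Suc show ?case by simp
qed simp

lemma nds_iter_commute:
  assumes "nds X f" "nds_commutative X f" "i \<ge> 1" "j \<ge> 1" "x \<in> X"
  shows "nds_iter f j m (nds_iter f i n x) = nds_iter f i n (nds_iter f j m x)"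
proof (induction m)
  case (Suc m)
  have "f (j + m) (nds_iter f i n (nds_iter f j m x)) = nds_iter f i n (f (j + m) (nds_iter f j m x))"
    using assms nds_iter_in[OF assms(1,4,5)] by (intro nds_iter_commute_map) auto
  with Suc show ?case by simp
qed simp

text \<open>Some ball around \<open>x\<close> misses the orbit within \<open>X\<close>. The
  neighbourhood is only relatively open, so the bound is restricted to iterates lying in
  \<open>X\<close>.\<close>

lemma nds_nonrecurrent_dist:
  assumes "nds_nonrecurrent X f x"
  obtains e where "e > 0" "\<And>n. n \<ge> 1 \<Longrightarrow> nds_iter f 1 n x \<in> X \<Longrightarrow> dist (nds_iter f 1 n x) x \<ge> e"
proof -
  let ?S = "{nds_iter f 1 i x | i. i \<ge> 1}"
  obtain T where T: "openin (top_of_set X) T" "x \<in> T" "T \<inter> ?S = {}"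
    using assms unfolding nds_nonrecurrent_def in_closure_of by auto
  then obtain e where "e > 0" and e: "ball x e \<inter> X \<subseteq> T"
    unfolding openin_contains_ball by blast
  have "dist (nds_iter f 1 n x) x \<ge> e" if "n \<ge> 1" "nds_iter f 1 n x \<in> X" for n
  proof (rule ccontr)
    assume "\<not> ?thesis"
    with that e have "nds_iter f 1 n x \<in> T" by (auto simp: dist_commute)
    with that T(3) show False by blast
  qed
  with \<open>e > 0\<close> that show ?thesis by blast
qed

lemma nds_transitive_uniformly_close_to_id:
  assumes nds: "nds X f" and comm: "nds_commutative X f" and trans: "nds_transitive X f"
    and U: "openin (top_of_set X) U" "U \<noteq> {}"
    and small: "\<And>x y n. x \<in> U \<Longrightarrow> y \<in> U \<Longrightarrow> n \<ge> 1 \<Longrightarrow>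
      dist (nds_iter f 1 n x) (nds_iter f 1 n y) \<le> \<delta>"
  obtains n where "n \<ge> 1" "\<And>x. x \<in> X \<Longrightarrow> dist (nds_iter f 1 n x) x \<le> \<delta>"
proof -
  let ?F = "nds_iter f 1"
  have UX: "U \<subseteq> X" using U openin_imp_subset by blast
  obtain n where n: "n \<ge> 1" "?F n ` U \<inter> U \<noteq> {}"
    using trans U unfolding nds_transitive_def by blast
  have cont: "continuous_on X (?F n)"
    using nds by (rule continuous_on_nds_iter) simp
  \<comment> \<open>Both \<open>u\<close> and \<open>?F n u\<close> lie in \<open>U\<close> for each
    \<open>u\<close> in \<open>U'\<close>, so \<open>small\<close> applies to this pair.\<close>
  define U' where "U' = U \<inter> (X \<inter> ?F n -` U)"
  have "openin (top_of_set X) (X \<inter> ?F n -` U)"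
    using nds_iter_in[OF nds] by (intro continuous_openin_preimage[OF cont _ U(1)]) auto
  then have U': "openin (top_of_set X) U'" "U' \<noteq> {}"
    unfolding U'_def using U(1) UX n(2) by auto
  have "dist (?F n x) x \<le> \<delta>" if "x \<in> X" for x
  proof (rule ccontr)
    assume far: "\<not> ?thesis"
    \<comment> \<open>The strict inequality makes \<open>V\<close> open, so transitivity sends a
      point of \<open>U'\<close> into \<open>V\<close>; this replaces a closure argument on a dense
      orbit.\<close>
    define V where "V = X \<inter> (\<lambda>x. dist (?F n x) x) -` {\<delta><..}"
    have "openin (top_of_set X) V"
      unfolding V_def using cont
      by (intro continuous_openin_preimage_gen continuous_intros) auto
    moreover have "x \<in> V" using far that by (simp add: V_def)
    ultimately obtain m where "m \<ge> 1" "?F m ` U' \<inter> V \<noteq> {}"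
      using trans U' unfolding nds_transitive_def by blast
    then obtain u where u: "u \<in> U'" "?F m u \<in> V" by blast
    \<comment> \<open>Hence the displacement of \<open>?F m u\<close> under \<open>?F n\<close> is
      the distance between the \<open>?F m\<close>-images of \<open>?F n u\<close> and
      \<open>u\<close>, at most \<delta>, contradicting membership in \<open>V\<close>.\<close>
    have "?F n (?F m u) = ?F m (?F n u)"
      using u(1) by (intro nds_iter_commute[OF nds comm]) (auto simp: U'_def)
    with u \<open>m \<ge> 1\<close> small[of "?F n u" u m] show False
      by (simp add: U'_def V_def)
  qed
  with n(1) that show ?thesis by blast
qed

theorem theorem14:
  fixes X :: "'a::metric_space set" and f :: "nat \<Rightarrow> 'a \<Rightarrow> 'a" and k :: nat and x1 :: 'a
  assumes "k \<ge> 1"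
    and "nds X f"
    and "nds_commutative X f"
    and "nds_periodic X f k"
    and "\<And>i. i \<ge> 1 \<Longrightarrow> f i ` X = X"
    and "compact X"
    and "\<And>x. x \<in> X \<Longrightarrow> \<not> x isolated_in X"
    and "nds_transitive X f"
    and "nds_nonrecurrent X f x1"
  shows "nds_sensitive X f"
proof -
  obtain e where "e > 0"
    and e: "\<And>n. n \<ge> 1 \<Longrightarrow> nds_iter f 1 n x1 \<in> X \<Longrightarrow> dist (nds_iter f 1 n x1) x1 \<ge> e"
    using nds_nonrecurrent_dist[OF assms(9)] by blast
  have x1: "x1 \<in> X" using assms(9) by (simp add: nds_nonrecurrent_def)
  \<comment> \<open>Halving \<open>e\<close> leaves a strict gap: a displacement of at most
    \<open>e / 2\<close> at \<open>x1\<close> contradicts the lower bound \<open>e\<close>.\<close>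
  have "\<exists>x\<in>U. \<exists>y\<in>U. \<exists>n\<ge>1. dist (nds_iter f 1 n x) (nds_iter f 1 n y) > e / 2"
    if U: "openin (top_of_set X) U" "U \<noteq> {}" for U
  proof (rule ccontr)
    assume "\<not> ?thesis"
    then have "\<And>x y n. x \<in> U \<Longrightarrow> y \<in> U \<Longrightarrow> n \<ge> 1 \<Longrightarrow>
        dist (nds_iter f 1 n x) (nds_iter f 1 n y) \<le> e / 2"
      by (meson not_less)
    from nds_transitive_uniformly_close_to_id[OF assms(2,3,8) U this]
    obtain n where n: "n \<ge> 1" "\<And>x. x \<in> X \<Longrightarrow> dist (nds_iter f 1 n x) x \<le> e / 2"
      by blast
    have "nds_iter f 1 n x1 \<in> X"
      using assms(2) x1 by (intro nds_iter_in) simp_all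
    with e[OF n(1)] n(2)[OF x1] \<open>e > 0\<close> show False by simp
  qed
  with \<open>e > 0\<close> show ?thesis
    unfolding nds_sensitive_def by (intro exI[of _ "e / 2"]) auto
qed

end
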